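(* Let $G$ be an infinite, finitely generated group. Let $M$ be a complex Banach space with norm $\|\cdot\|_M$ that is also a left $\mathbb{C}G$-module such that the elements of $G$ act on $M$ as continuous $\mathbb{C}$-linear transformations. Suppose that $\mathbb{C}G\subset M\subset L^p(G)$ for some $p\in\mathbb{N}$, $p\ge 1$ (inclusions of $G$-modules). If $H^1(G,M)=0$, then $G$ has exactly $1$ end.
   Context: $\mathbb{C}G$ is the set of finite formal sums $\sum_{g\in G}a_g g$ with $a_g\in\mathbb{C}$. For $1\le p<\infty$, $L^p(G)$ is the set of all (not necessarily finite) formal sums $\sum_{g\in G}a_g g$, $a_g\in\mathbb{C}$, with $\sum_g|a_g|^p<\infty$. $G$ acts on both by left multiplication: $h\cdot\sum_g a_g g=\sum_g a_g\,hg$. For a $G$-module $N$ (a $\mathbb{C}$-vector space with a homomorphism $G\to\mathrm{Aut}(N)$), $H^1(G,N)=A_G/B_G$, where $A_G$ is the set of maps $f:G\to N$ with $a\cdot f(b)-f(ab)+f(a)=0$ for all $a,b\in G$, and $B_G$ is the set of maps of the form $f(b)=b\cdot\alpha-\alpha$ for some fixed $\alpha\in N$. The number of ends of a finitely generated group is the number of ends of its Cayley graph with respect to a finite generating set. *)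

theory Defs
  imports
    "HOL-Analysis.Analysis"
    "HOL-Algebra.Algebra"
    "HOL-Library.Function_Algebras"
begin

section \<open>Ends of graphs and Cayley graphs\<close>

text \<open>A graph is given by its adjacency relation. An end is a class of rays, two rays being
  equivalent if for every finite vertex set \<open>K\<close> they have tails in the same connected
  component of the graph with \<open>K\<close> removed.\<close>

definition connected_off :: "('v \<Rightarrow> 'v \<Rightarrow> bool) \<Rightarrow> 'v set \<Rightarrow> 'v \<Rightarrow> 'v \<Rightarrow> bool" where
  "connected_off E K x y \<longleftrightarrow>
     x \<notin> K \<and> y \<notin> K \<and> (\<lambda>u v. E u v \<and> u \<notin> K \<and> v \<notin> K)\<^sup>*\<^sup>* x y"

definition rays :: "('v \<Rightarrow> 'v \<Rightarrow> bool) \<Rightarrow> (nat \<Rightarrow> 'v) set" where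
  "rays E = {r. inj r \<and> (\<forall>n. E (r n) (r (Suc n)))}"

definition end_rel :: "('v \<Rightarrow> 'v \<Rightarrow> bool) \<Rightarrow> ((nat \<Rightarrow> 'v) \<times> (nat \<Rightarrow> 'v)) set" where
  "end_rel E = {(r, s). r \<in> rays E \<and> s \<in> rays E \<and>
     (\<forall>K. finite K \<longrightarrow> (\<exists>m. \<forall>i\<ge>m. \<forall>j\<ge>m. connected_off E K (r i) (s j)))}"

definition ends :: "('v \<Rightarrow> 'v \<Rightarrow> bool) \<Rightarrow> (nat \<Rightarrow> 'v) set set" where
  "ends E = rays E // end_rel E"

text \<open>Edges join \<open>x\<close> to \<open>x s\<close>, so that left multiplication acts by graph automorphisms.\<close>

definition cayley_adj :: "('g, 'c) monoid_scheme \<Rightarrow> 'g set \<Rightarrow> 'g \<Rightarrow> 'g \<Rightarrow> bool" where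
  "cayley_adj G S x y \<longleftrightarrow> x \<in> carrier G \<and> y \<in> carrier G \<and> x \<noteq> y \<and>
     (\<exists>s\<in>S. y = x \<otimes>\<^bsub>G\<^esub> s \<or> x = y \<otimes>\<^bsub>G\<^esub> s)"

lemma equiv_end_rel:
  assumes "symp E"
  shows "equiv (rays E) (end_rel E)"
proof (rule equivI)
  have sym_off: "connected_off E K y x" if "connected_off E K x y" for K x y
  proof -
    have "symp (\<lambda>u v. E u v \<and> u \<notin> K \<and> v \<notin> K)"
      using assms by (auto simp: symp_def)
    then have "symp (\<lambda>u v. E u v \<and> u \<notin> K \<and> v \<notin> K)\<^sup>*\<^sup>*"
      by (rule symp_rtranclp)
    then show ?thesis
      using that by (auto simp: connected_off_def symp_def)
  qed
  have tail: "\<exists>m. \<forall>i\<ge>m. \<forall>j\<ge>m. connected_off E K (r i) (r j)"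
    if r: "r \<in> rays E" and K: "finite K" for r K
  proof -
    have "finite (r -` K)"
      using r K by (auto simp: rays_def intro: finite_vimageI)
    then obtain m where m: "\<And>i. i \<ge> m \<Longrightarrow> r i \<notin> K"
      by (metis finite_nat_set_iff_bounded not_less vimageI)
    have up: "connected_off E K (r i) (r (i + k))" if "i \<ge> m" for i k
    proof (induction k)
      case 0
      then show ?case using m that by (simp add: connected_off_def)
    next
      case (Suc k)
      have "E (r (i + k)) (r (i + Suc k))" using r by (simp add: rays_def)
      moreover have "r (i + k) \<notin> K" "r (i + Suc k) \<notin> K" using m that by simp_all
      ultimately show ?case
        using Suc unfolding connected_off_def by (metis (mono_tags, lifting) rtranclp.rtrancl_into_rtrancl)
    qed
    have "connected_off E K (r i) (r j)" if "i \<ge> m" "j \<ge> m" for i j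
    proof (cases "i \<le> j")
      case True
      then show ?thesis using up[of i "j - i"] that by simp
    next
      case False
      then show ?thesis using up[of j "i - j"] that by (auto intro: sym_off)
    qed
    then show ?thesis by blast
  qed
  have tails: "\<exists>m. \<forall>i\<ge>m. \<forall>j\<ge>m. connected_off E K (r i) (s j)"
    if "(r, s) \<in> end_rel E" "finite K" for r s K
    using that by (simp add: end_rel_def)
  show "end_rel E \<subseteq> rays E \<times> rays E"
    by (auto simp: end_rel_def)
  show "refl_on (rays E) (end_rel E)"
    using tail by (auto simp: refl_on_def end_rel_def)
  show "sym (end_rel E)"
  proof (rule symI)
    fix r s assume rs: "(r, s) \<in> end_rel E"
    have "\<exists>m. \<forall>i\<ge>m. \<forall>j\<ge>m. connected_off E K (s i) (r j)" if K: "finite K" for K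
    proof -
      obtain m where m: "\<And>i j. i \<ge> m \<Longrightarrow> j \<ge> m \<Longrightarrow> connected_off E K (r i) (s j)"
        using tails[OF rs K] by (elim exE) (rule that, iprover)
      have "\<forall>i\<ge>m. \<forall>j\<ge>m. connected_off E K (s i) (r j)"
        using sym_off[OF m] by iprover
      then show ?thesis ..
    qed
    with rs show "(s, r) \<in> end_rel E" by (simp add: end_rel_def)
  qed
  show "trans (end_rel E)"
  proof (rule transI)
    fix r s t assume rs: "(r, s) \<in> end_rel E" and st: "(s, t) \<in> end_rel E"
    have "\<exists>m. \<forall>i\<ge>m. \<forall>j\<ge>m. connected_off E K (r i) (t j)" if K: "finite K" for K
    proof -
      obtain m where m: "\<And>i j. i \<ge> m \<Longrightarrow> j \<ge> m \<Longrightarrow> connected_off E K (r i) (s j)"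
        using tails[OF rs K] by (elim exE) (rule that, iprover)
      obtain n where n: "\<And>i j. i \<ge> n \<Longrightarrow> j \<ge> n \<Longrightarrow> connected_off E K (s i) (t j)"
        using tails[OF st K] by (elim exE) (rule that, iprover)
      have "connected_off E K (r i) (t j)" if "i \<ge> max m n" "j \<ge> max m n" for i j
        using m[of i "max m n"] n[of "max m n" j] that
        by (auto simp: connected_off_def)
      then show ?thesis by blast
    qed
    with rs st show "(r, t) \<in> end_rel E" by (auto simp: end_rel_def)
  qed
qed

lemma symp_cayley_adj: "symp (cayley_adj G S)"
  by (auto simp: symp_def cayley_adj_def)


section \<open>Complex Banach spaces and modules over a group\<close>

text \<open>The class \<^class>\<open>banach\<close> provides the norm and completeness; complex scalars are added
  compatibly with the real ones.\<close>

locale complex_banach_space = vector_space cscale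
  for cscale :: "complex \<Rightarrow> 'm::banach \<Rightarrow> 'm" +
  assumes cscale_of_real: "cscale (complex_of_real r) x = r *\<^sub>R x"
    and norm_cscale: "norm (cscale c x) = cmod c * norm x"

locale G_module = group_action G UNIV act + vector_space cscale
  for G :: "('g, 'c) monoid_scheme" (structure)
    and cscale :: "complex \<Rightarrow> 'n::ab_group_add \<Rightarrow> 'n"
    and act :: "'g \<Rightarrow> 'n \<Rightarrow> 'n" +
  assumes linear_act: "g \<in> carrier G \<Longrightarrow> Vector_Spaces.linear cscale cscale (act g)"


section \<open>First cohomology\<close>

text \<open>Maps on the carrier are represented by functions that are \<^const>\<open>undefined\<close> outside it.\<close>

definition cocycles :: "('g, 'c) monoid_scheme \<Rightarrow> ('g \<Rightarrow> 'n \<Rightarrow> 'n) \<Rightarrow> ('g \<Rightarrow> 'n::ab_group_add) set"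
  where "cocycles G act = {f \<in> extensional (carrier G).
     \<forall>a\<in>carrier G. \<forall>b\<in>carrier G. act a (f b) - f (a \<otimes>\<^bsub>G\<^esub> b) + f a = 0}"

definition coboundaries :: "('g, 'c) monoid_scheme \<Rightarrow> ('g \<Rightarrow> 'n \<Rightarrow> 'n) \<Rightarrow> ('g \<Rightarrow> 'n::ab_group_add) set"
  where "coboundaries G act = range (\<lambda>\<alpha>. \<lambda>b\<in>carrier G. act b \<alpha> - \<alpha>)"

definition cocycle_group ::
    "('g, 'c) monoid_scheme \<Rightarrow> ('g \<Rightarrow> 'n \<Rightarrow> 'n) \<Rightarrow> ('g \<Rightarrow> 'n::ab_group_add) monoid"
  where "cocycle_group G act =
    \<lparr>carrier = cocycles G act,
     mult = (\<lambda>f h. \<lambda>b\<in>carrier G. f b + h b),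
     one = (\<lambda>b\<in>carrier G. 0)\<rparr>"

definition H1 ::
    "('g, 'c) monoid_scheme \<Rightarrow> ('g \<Rightarrow> 'n \<Rightarrow> 'n) \<Rightarrow> ('g \<Rightarrow> 'n::ab_group_add) set monoid"
  where "H1 G act = cocycle_group G act Mod coboundaries G act"

context G_module
begin

lemma act_add: "g \<in> carrier G \<Longrightarrow> act g (x + y) = act g x + act g y"
  and act_diff: "g \<in> carrier G \<Longrightarrow> act g (x - y) = act g x - act g y"
  and act_zero: "g \<in> carrier G \<Longrightarrow> act g 0 = 0"
  and act_minus: "g \<in> carrier G \<Longrightarrow> act g (- x) = - act g x"
  using linear_act[of g]
  by (simp_all add: Vector_Spaces.linear.axioms module_hom.add module_hom.diff
      module_hom.zero module_hom.neg Vector_Spaces.linear_iff_module_hom)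

lemma act_act:
  "a \<in> carrier G \<Longrightarrow> b \<in> carrier G \<Longrightarrow> act (a \<otimes> b) x = act a (act b x)"
  using composition_rule[of x a b] by simp

lemma group_G: "group G"
  using group_hom by (simp add: group_hom_def)

lemma comm_group_cocycle_group: "comm_group (cocycle_group G act)"
proof (rule comm_groupI)
  interpret group G by (rule group_G)
  fix f h k
  assume f: "f \<in> carrier (cocycle_group G act)"
  show "\<exists>y\<in>carrier (cocycle_group G act).
      y \<otimes>\<^bsub>cocycle_group G act\<^esub> f = \<one>\<^bsub>cocycle_group G act\<^esub>"
  proof (rule bexI[of _ "\<lambda>b\<in>carrier G. - f b"])
    have "- act a (f b) + f (a \<otimes> b) - f a = 0" if "a \<in> carrier G" "b \<in> carrier G" for a b
    proof -
      have "- act a (f b) + f (a \<otimes> b) - f a = - (act a (f b) - f (a \<otimes> b) + f a)"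
        by simp
      also have "\<dots> = 0"
        using f that by (simp add: cocycle_group_def cocycles_def del: minus_add_distrib minus_diff_eq)
      finally show ?thesis .
    qed
    then show "(\<lambda>b\<in>carrier G. - f b) \<in> carrier (cocycle_group G act)"
      by (simp add: cocycle_group_def cocycles_def act_minus)
  qed (auto simp: cocycle_group_def)
  show "\<one>\<^bsub>cocycle_group G act\<^esub> \<otimes>\<^bsub>cocycle_group G act\<^esub> f = f"
    using f by (auto simp: cocycle_group_def cocycles_def fun_eq_iff extensional_def)
  assume h: "h \<in> carrier (cocycle_group G act)"
  have "act a (f b) + act a (h b) - (f (a \<otimes> b) + h (a \<otimes> b)) + (f a + h a) = 0"
    if "a \<in> carrier G" "b \<in> carrier G" for a b
  proof -
    have "act a (f b) + act a (h b) - (f (a \<otimes> b) + h (a \<otimes> b)) + (f a + h a) =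
        (act a (f b) - f (a \<otimes> b) + f a) + (act a (h b) - h (a \<otimes> b) + h a)"
      by (simp only: algebra_simps)
    also have "\<dots> = 0"
    proof -
      have "act a (f b) - f (a \<otimes> b) + f a = 0" "act a (h b) - h (a \<otimes> b) + h a = 0"
        using f h that by (auto simp only: cocycle_group_def cocycles_def
            partial_object.simps mem_Collect_eq)
      then show ?thesis by simp
    qed
    finally show ?thesis .
  qed
  then show "f \<otimes>\<^bsub>cocycle_group G act\<^esub> h \<in> carrier (cocycle_group G act)"
    by (simp add: cocycle_group_def cocycles_def act_add)
  show "f \<otimes>\<^bsub>cocycle_group G act\<^esub> h = h \<otimes>\<^bsub>cocycle_group G act\<^esub> f"
    by (auto simp: cocycle_group_def fun_eq_iff)
  show "f \<otimes>\<^bsub>cocycle_group G act\<^esub> h \<otimes>\<^bsub>cocycle_group G act\<^esub> k =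
      f \<otimes>\<^bsub>cocycle_group G act\<^esub> (h \<otimes>\<^bsub>cocycle_group G act\<^esub> k)"
    by (auto simp: cocycle_group_def fun_eq_iff)
next
  show "\<one>\<^bsub>cocycle_group G act\<^esub> \<in> carrier (cocycle_group G act)"
    using group_G by (auto simp: cocycle_group_def cocycles_def act_zero group.is_monoid monoid.m_closed)
qed

lemma subgroup_coboundaries: "subgroup (coboundaries G act) (cocycle_group G act)"
proof -
  interpret group G by (rule group_G)
  interpret C: comm_group "cocycle_group G act" by (rule comm_group_cocycle_group)
  have sub: "coboundaries G act \<subseteq> carrier (cocycle_group G act)"
    by (auto simp: coboundaries_def cocycle_group_def cocycles_def act_diff act_act)
  have closed: "f \<otimes>\<^bsub>cocycle_group G act\<^esub> h \<in> coboundaries G act"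
    if fh: "f \<in> coboundaries G act" "h \<in> coboundaries G act" for f h
  proof -
    obtain \<alpha> \<beta> where "f = (\<lambda>b\<in>carrier G. act b \<alpha> - \<alpha>)" "h = (\<lambda>b\<in>carrier G. act b \<beta> - \<beta>)"
      using fh unfolding coboundaries_def by blast
    then have "f \<otimes>\<^bsub>cocycle_group G act\<^esub> h = (\<lambda>b\<in>carrier G. act b (\<alpha> + \<beta>) - (\<alpha> + \<beta>))"
      by (auto simp: cocycle_group_def fun_eq_iff act_add)
    then show ?thesis by (auto simp: coboundaries_def)
  qed
  have inv: "inv\<^bsub>cocycle_group G act\<^esub> f \<in> coboundaries G act" if f: "f \<in> coboundaries G act" for f
  proof -
    obtain \<alpha> where \<alpha>: "f = (\<lambda>b\<in>carrier G. act b \<alpha> - \<alpha>)"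
      using f unfolding coboundaries_def by blast
    let ?h = "\<lambda>b\<in>carrier G. act b (- \<alpha>) - (- \<alpha>)"
    have h: "?h \<in> coboundaries G act" unfolding coboundaries_def by (rule rangeI)
    have "?h \<otimes>\<^bsub>cocycle_group G act\<^esub> f = \<one>\<^bsub>cocycle_group G act\<^esub>"
      using \<alpha> by (auto simp: cocycle_group_def fun_eq_iff act_minus)
    then have "inv\<^bsub>cocycle_group G act\<^esub> f = ?h"
      using sub f h by (intro C.inv_equality) auto
    with h show ?thesis by simp
  qed
  have "(\<lambda>b\<in>carrier G. act b 0 - 0) \<in> coboundaries G act"
    unfolding coboundaries_def by (rule rangeI)
  then show ?thesis
    using sub closed inv by (intro C.subgroupI) auto
qed

end


section \<open>Formal sums over a group\<close>

text \<open>The formal sum of the \<open>a g \<cdot> g\<close> over \<open>g \<in> carrier G\<close> is represented by its coefficient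
  function \<open>a\<close>, extended by \<open>0\<close> outside the carrier.\<close>

definition group_ring :: "('g, 'c) monoid_scheme \<Rightarrow> ('g \<Rightarrow> complex) set" where
  "group_ring G = {a. (\<forall>x. x \<notin> carrier G \<longrightarrow> a x = 0) \<and> finite {x. a x \<noteq> 0}}"

definition Lp :: "('g, 'c) monoid_scheme \<Rightarrow> real \<Rightarrow> ('g \<Rightarrow> complex) set" where
  "Lp G p = {a. (\<forall>x. x \<notin> carrier G \<longrightarrow> a x = 0) \<and> (\<lambda>x. cmod (a x) powr p) summable_on carrier G}"

text \<open>The coefficient of \<open>h \<cdot> a\<close> at \<open>x = h g\<close> is that of \<open>a\<close> at \<open>g\<close>.\<close>

definition left_translate ::
    "('g, 'c) monoid_scheme \<Rightarrow> 'g \<Rightarrow> ('g \<Rightarrow> complex) \<Rightarrow> 'g \<Rightarrow> complex" where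
  "left_translate G h a =
     (\<lambda>x. if x \<in> carrier G then a (inv\<^bsub>G\<^esub> h \<otimes>\<^bsub>G\<^esub> x) else 0)"

definition fun_cscale :: "complex \<Rightarrow> ('g \<Rightarrow> complex) \<Rightarrow> 'g \<Rightarrow> complex" where
  "fun_cscale c a = (\<lambda>x. c * a x)"

text \<open>An inclusion of a \<open>G\<close>-module into the formal sums: an injective \<open>\<complex>\<close>-linear
  \<open>G\<close>-equivariant map.\<close>

definition formal_sum_inclusion ::
    "('g, 'c) monoid_scheme \<Rightarrow> (complex \<Rightarrow> 'n::ab_group_add \<Rightarrow> 'n) \<Rightarrow> ('g \<Rightarrow> 'n \<Rightarrow> 'n)
      \<Rightarrow> ('n \<Rightarrow> 'g \<Rightarrow> complex) \<Rightarrow> bool" where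
  "formal_sum_inclusion G cscale act \<iota> \<longleftrightarrow>
     Vector_Spaces.linear cscale fun_cscale \<iota> \<and> inj \<iota> \<and>
     (\<forall>g\<in>carrier G. \<forall>x. \<iota> (act g x) = left_translate G g (\<iota> x))"

lemma vector_space_fun_cscale: "vector_space fun_cscale"
  by unfold_locales (auto simp: fun_cscale_def fun_eq_iff algebra_simps)

end

theory Submission
  imports Defs
begin

text \<open>An infinite, locally finite, connected graph has a ray, so \<open>G\<close> has at least one end. Suppose
  that two rays of the Cayley graph are inequivalent. Some finite set \<open>K\<close> of vertices separates
  their tails, and the component \<open>A\<close> of the graph without \<open>K\<close> that contains a tail of the first
  ray is infinite, has infinite complement, and differs from \<open>A g\<close> by a finite set for every
  \<open>g\<close> (lemma \<open>almost_right_invariant\<close>). The set \<open>B\<close> of inverses of \<open>A\<close> has the same properties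
  for left translation, so that \<open>g \<cdot> 1\<^sub>B - 1\<^sub>B\<close> lies in the group ring, hence in the
  module \<open>M\<close>, for every \<open>g\<close>.

  The map \<open>g \<mapsto> g \<cdot> 1\<^sub>B - 1\<^sub>B\<close> is a cocycle with values in \<open>M\<close>. It is formally the coboundary of
  \<open>1\<^sub>B\<close>, which need not lie in \<open>M\<close>. Vanishing of the first cohomology gives \<open>\<alpha>\<close> in \<open>M\<close> with the
  same coboundary; then \<open>1\<^sub>B - \<alpha>\<close> is invariant under left translation, hence a constant
  \<open>c\<close>. So \<open>\<alpha>\<close> is \<open>1 - c\<close> on the infinite set \<open>B\<close> and \<open>- c\<close> on its infinite complement. As a
  \<open>p\<close>-summable function cannot take a nonzero constant value on an infinite set, \<open>c = 1\<close> and
  \<open>c = 0\<close>, a contradiction.\<close>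


section \<open>Rays in locally finite graphs\<close>

text \<open>Koenig's lemma: a finitely branching relation with infinitely many points reachable from \<open>x\<close>
  has an infinite path from \<open>x\<close>, found by always stepping to a point from which infinitely many
  points are reachable.\<close>

lemma koenig:
  assumes fin: "\<And>x. finite {y. R x y}" and inf: "infinite {y. R\<^sup>*\<^sup>* x y}"
  obtains r :: "nat \<Rightarrow> 'v" where "r 0 = x" "\<And>n. R (r n) (r (Suc n))"
proof -
  have step: "\<exists>z. infinite {y. R\<^sup>*\<^sup>* z y} \<and> R u z" if u: "infinite {y. R\<^sup>*\<^sup>* u y}" for u
  proof (rule ccontr)
    assume "\<not> ?thesis"
    then have "finite (insert u (\<Union>z\<in>{z. R u z}. {y. R\<^sup>*\<^sup>* z y}))"
      using fin by auto
    moreover have "{y. R\<^sup>*\<^sup>* u y} \<subseteq> insert u (\<Union>z\<in>{z. R u z}. {y. R\<^sup>*\<^sup>* z y})"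
      by (auto elim: converse_rtranclpE)
    ultimately show False using u finite_subset by blast
  qed
  have "\<exists>r. \<forall>n. (infinite {y. R\<^sup>*\<^sup>* (r n) y} \<and> (n = 0 \<longrightarrow> r n = x)) \<and> R (r n) (r (Suc n))"
    by (rule dependent_nat_choice) (use inf step in auto)
  then show ?thesis using that by blast
qed

text \<open>Every vertex of the component of \<open>v\<close> is reached by steps that increase the distance from
  \<open>v\<close> by one, and an infinite path of such steps is injective. So Koenig's lemma is applied to
  these steps.\<close>

lemma rays_nonempty:
  fixes E :: "'v \<Rightarrow> 'v \<Rightarrow> bool"
  assumes fin: "\<And>x. finite {y. E x y}" and inf: "infinite {y. E\<^sup>*\<^sup>* v y}"
  shows "rays E \<noteq> {}"
proof -
  define d where "d x = (LEAST n. (E ^^ n) v x)" for x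
  define R where "R x y \<longleftrightarrow> E x y \<and> d y = Suc (d x)" for x y
  have d_least: "d x \<le> n" if "(E ^^ n) v x" for n x
    unfolding d_def by (rule Least_le) (rule that)
  have d_path: "(E ^^ d x) v x" if "E\<^sup>*\<^sup>* v x" for x
  proof -
    from that obtain n where "(E ^^ n) v x" by (meson rtranclp_imp_relpowp)
    then show ?thesis unfolding d_def by (rule LeastI)
  qed
  have geodesic: "R\<^sup>*\<^sup>* v x" if "E\<^sup>*\<^sup>* v x" for x
    using that
  proof (induction "d x" arbitrary: x)
    case 0
    then have "(E ^^ 0) v x" using d_path[of x] by simp
    then show ?case by simp
  next
    case (Suc n)
    then have "(E ^^ Suc n) v x" using d_path[of x] by simp
    then obtain y where y: "(E ^^ n) v y" "E y x" by auto
    then have vy: "E\<^sup>*\<^sup>* v y" by (meson relpowp_imp_rtranclp)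
    have "(E ^^ Suc (d y)) v x" using d_path[OF vy] y(2) by auto
    then have "d x \<le> Suc (d y)" by (rule d_least)
    then have "d y = n" using d_least[OF y(1)] Suc.hyps(2) by simp
    then have "R\<^sup>*\<^sup>* v y" "R y x" using Suc y vy by (auto simp: R_def)
    then show ?case by (rule rtranclp.rtrancl_into_rtrancl)
  qed
  have "finite {y. R x y}" for x
    by (rule finite_subset[OF _ fin[of x]]) (auto simp: R_def)
  moreover have "infinite {y. R\<^sup>*\<^sup>* v y}"
    using inf finite_subset[of "{y. E\<^sup>*\<^sup>* v y}" "{y. R\<^sup>*\<^sup>* v y}"] geodesic by blast
  ultimately obtain r where r: "\<And>n. R (r n) (r (Suc n))"
    using koenig[of R v] by blast
  have "strict_mono (\<lambda>n. d (r n))"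
    using r by (auto simp: R_def intro: strict_monoI_Suc)
  then have "inj r"
    by (metis (mono_tags, lifting) injI strict_mono_eq)
  then have "r \<in> rays E" using r by (auto simp: rays_def R_def)
  then show ?thesis by blast
qed

lemma connected_off_sym:
  assumes "symp E" "connected_off E K x y"
  shows "connected_off E K y x"
proof -
  have "symp (\<lambda>u v. E u v \<and> u \<notin> K \<and> v \<notin> K)"
    using assms(1) by (auto simp: symp_def)
  then have "symp (\<lambda>u v. E u v \<and> u \<notin> K \<and> v \<notin> K)\<^sup>*\<^sup>*"
    by (rule symp_rtranclp)
  then show ?thesis
    using assms(2) by (auto simp: connected_off_def symp_def)
qed

lemma connected_off_trans:
  "connected_off E K x y \<Longrightarrow> connected_off E K y z \<Longrightarrow> connected_off E K x z"
  by (auto simp: connected_off_def)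

text \<open>The set \<open>A\<close> is the component, off a separating set \<open>K\<close>, of a tail of \<open>r\<close>.\<close>

lemma inequivalent_rays_separated:
  assumes E: "symp E" and r: "r \<in> rays E" and s: "s \<in> rays E" and ne: "(r, s) \<notin> end_rel E"
  obtains K A where "finite K" "infinite (range r \<inter> A)" "infinite (range s - A)"
    "\<And>x y. x \<in> A \<Longrightarrow> E x y \<Longrightarrow> y \<in> A \<union> K"
proof -
  from ne r s obtain K where K: "finite K"
    and sep: "\<And>m. \<exists>i\<ge>m. \<exists>j\<ge>m. \<not> connected_off E K (r i) (s j)"
    by (auto simp: end_rel_def)
  have tail: "\<exists>m. \<forall>i\<ge>m. \<forall>j\<ge>m. connected_off E K (t i) (t j)" if "t \<in> rays E" for t
    using equiv_end_rel[OF E] that K by (auto simp: equiv_def refl_on_def end_rel_def)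
  obtain mr where mr: "\<And>i j. i \<ge> mr \<Longrightarrow> j \<ge> mr \<Longrightarrow> connected_off E K (r i) (r j)"
    using tail[OF r] by blast
  obtain ms where ms: "\<And>i j. i \<ge> ms \<Longrightarrow> j \<ge> ms \<Longrightarrow> connected_off E K (s i) (s j)"
    using tail[OF s] by blast
  define m where "m = max mr ms"
  define A where "A = {x. connected_off E K (r m) x}"
  have rA: "r ` {m..} \<subseteq> range r \<inter> A"
    using mr by (auto simp: A_def m_def)
  have "s j \<notin> A" if "j \<ge> m" for j
  proof
    assume j: "s j \<in> A"
    have "connected_off E K (r i) (s k)" if "i \<ge> m" "k \<ge> m" for i k
    proof -
      have "connected_off E K (r i) (r m)" "connected_off E K (s j) (s k)"
        using that \<open>j \<ge> m\<close> mr ms by (simp_all add: m_def)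
      with j show ?thesis unfolding A_def by (blast intro: connected_off_trans)
    qed
    with sep[of m] show False by blast
  qed
  then have sA: "s ` {m..} \<subseteq> range s - A" by auto
  have inf: "infinite (t ` {m..})" if "t \<in> rays E" for t
    using that finite_imageD[of t "{m..}"] infinite_Ici[of m]
    by (auto simp: rays_def intro: inj_on_subset)
  have step: "y \<in> A \<union> K" if "x \<in> A" "E x y" for x y
  proof (cases "y \<in> K")
    case False
    with that show ?thesis
      unfolding A_def connected_off_def
      by (auto intro: rtranclp.rtrancl_into_rtrancl)
  qed simp
  show ?thesis
    using K infinite_super[OF rA inf[OF r]] infinite_super[OF sA inf[OF s]] step by (rule that)
qed


section \<open>Cayley graphs\<close>

context group
begin

lemma cayley_adj_locally_finite:
  assumes "finite S" "S \<subseteq> carrier G"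
  shows "finite {y. cayley_adj G S x y}"
proof (rule finite_subset)
  show "{y. cayley_adj G S x y} \<subseteq> (\<lambda>s. x \<otimes> s) ` S \<union> (\<lambda>s. x \<otimes> inv s) ` S"
  proof
    fix y assume "y \<in> {y. cayley_adj G S x y}"
    then obtain s where y: "x \<in> carrier G" "y \<in> carrier G" "s \<in> S" "y = x \<otimes> s \<or> x = y \<otimes> s"
      by (auto simp: cayley_adj_def)
    moreover have "y = x \<otimes> inv s" if "x = y \<otimes> s"
      using y(2,3) that assms(2) by (auto simp: m_assoc)
    ultimately show "y \<in> (\<lambda>s. x \<otimes> s) ` S \<union> (\<lambda>s. x \<otimes> inv s) ` S" by blast
  qed
qed (use assms in simp)

lemma cayley_adj_connected:
  assumes S: "S \<subseteq> carrier G" and h: "h \<in> generate G S" and x: "x \<in> carrier G"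
  shows "(cayley_adj G S)\<^sup>*\<^sup>* x (x \<otimes> h)"
  using h x
proof (induction h arbitrary: x)
  case (incl s)
  then show ?case
    using S by (cases "x = x \<otimes> s") (auto simp: cayley_adj_def intro!: r_into_rtranclp)
next
  case (inv s)
  then have s: "s \<in> carrier G" "x = x \<otimes> inv s \<otimes> s" using S by (auto simp: m_assoc)
  then have "x \<otimes> inv s \<in> carrier G" using inv by simp
  then have "cayley_adj G S x (x \<otimes> inv s)" if "x \<noteq> x \<otimes> inv s"
    using inv s that unfolding cayley_adj_def by blast
  then show ?case by (cases "x = x \<otimes> inv s") auto
next
  case (eng h1 h2)
  have "h1 \<in> carrier G" "h2 \<in> carrier G" using eng generate_in_carrier[OF S] by auto
  moreover from this have "(cayley_adj G S)\<^sup>*\<^sup>* (x \<otimes> h1) (x \<otimes> h1 \<otimes> h2)"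
    using eng by simp
  ultimately show ?case using eng by (auto simp: m_assoc intro: rtranclp_trans)
qed simp

lemma cayley_rays_nonempty:
  assumes "infinite (carrier G)" "finite S" "S \<subseteq> carrier G" "generate G S = carrier G"
  shows "rays (cayley_adj G S) \<noteq> {}"
proof (rule rays_nonempty[where v = \<one>])
  have "carrier G \<subseteq> {y. (cayley_adj G S)\<^sup>*\<^sup>* \<one> y}"
    using cayley_adj_connected[OF assms(3), of _ \<one>] assms(4) by auto
  then show "infinite {y. (cayley_adj G S)\<^sup>*\<^sup>* \<one> y}"
    using assms(1) infinite_super by blast
qed (rule cayley_adj_locally_finite[OF assms(2,3)])

lemma rays_in_carrier: "r \<in> rays (cayley_adj G S) \<Longrightarrow> range r \<subseteq> carrier G"
  by (auto simp: rays_def cayley_adj_def)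

text \<open>A set that edges leave only into a finite set \<open>K\<close> changes under right translation by a
  finite set only: this holds for the generators, and the elements for which it holds form a
  subgroup.\<close>

lemma almost_right_invariant:
  assumes S: "S \<subseteq> carrier G" and K: "finite K"
    and bd: "\<And>x y. x \<in> A \<Longrightarrow> cayley_adj G S x y \<Longrightarrow> y \<in> A \<union> K"
    and g: "g \<in> generate G S"
  shows "finite {x \<in> carrier G. x \<in> A \<longleftrightarrow> x \<otimes> g \<notin> A}"
proof -
  have gen: "finite {x \<in> carrier G. x \<in> A \<longleftrightarrow> x \<otimes> s \<notin> A}" if s: "s \<in> S" for s
  proof (rule finite_subset)
    show "{x \<in> carrier G. x \<in> A \<longleftrightarrow> x \<otimes> s \<notin> A} \<subseteq> K \<union> (\<lambda>y. y \<otimes> inv s) ` K"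
    proof
      fix x assume "x \<in> {x \<in> carrier G. x \<in> A \<longleftrightarrow> x \<otimes> s \<notin> A}"
      then have x: "x \<in> carrier G" "x \<in> A \<longleftrightarrow> x \<otimes> s \<notin> A" by auto
      then have adj: "cayley_adj G S x (x \<otimes> s)"
        using s S by (auto simp: cayley_adj_def)
      then have adj': "cayley_adj G S (x \<otimes> s) x"
        using symp_cayley_adj[of G S] by (auto simp: symp_def)
      have "x = x \<otimes> s \<otimes> inv s" using x s S by (auto simp: m_assoc)
      moreover have "x \<in> K \<or> x \<otimes> s \<in> K"
        using bd[OF _ adj] bd[OF _ adj'] x(2) by blast
      ultimately show "x \<in> K \<union> (\<lambda>y. y \<otimes> inv s) ` K" by blast
    qed
  qed (use K in simp)
  show ?thesis using g
  proof (induction g)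
    case one
    then show ?case by (auto intro: finite_subset[of _ "{}"])
  next
    case (incl s)
    then show ?case by (rule gen)
  next
    case (inv s)
    then have s: "s \<in> carrier G" using S by blast
    have "x \<in> (\<lambda>y. y \<otimes> s) ` {x \<in> carrier G. x \<in> A \<longleftrightarrow> x \<otimes> s \<notin> A}"
      if "x \<in> carrier G" "x \<in> A \<longleftrightarrow> x \<otimes> inv s \<notin> A" for x
      using that s by (intro image_eqI[of _ _ "x \<otimes> inv s"]) (auto simp: m_assoc)
    then show ?case
      by (intro finite_subset[OF _ finite_imageI[OF gen[OF inv], of "\<lambda>y. y \<otimes> s"]]) blast
  next
    case (eng h1 h2)
    have h: "h1 \<in> carrier G" "h2 \<in> carrier G" using eng generate_in_carrier[OF S] by auto
    let ?D = "\<lambda>g. {x \<in> carrier G. x \<in> A \<longleftrightarrow> x \<otimes> g \<notin> A}"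
    have "x \<in> ?D h1 \<union> (\<lambda>y. y \<otimes> inv h1) ` ?D h2" if x: "x \<in> ?D (h1 \<otimes> h2)" for x
    proof (cases "x \<in> ?D h1")
      case False
      then have "x \<otimes> h1 \<in> ?D h2" using x h by (auto simp: m_assoc)
      moreover have "x = x \<otimes> h1 \<otimes> inv h1" using x h by (auto simp: m_assoc)
      ultimately show ?thesis by blast
    qed simp
    then show ?case
      using eng by (intro finite_subset[of "?D (h1 \<otimes> h2)" "?D h1 \<union> (\<lambda>y. y \<otimes> inv h1) ` ?D h2"]) auto
  qed
qed

end


section \<open>Cohomology with coefficients in formal sums\<close>

context G_module
begin

lemma cocycles_subset_coboundaries:
  assumes "trivial_group (H1 G act)"
  shows "cocycles G act \<subseteq> coboundaries G act"
proof
  interpret C: comm_group "cocycle_group G act" by (rule comm_group_cocycle_group)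
  fix f assume "f \<in> cocycles G act"
  then have f: "f \<in> carrier (cocycle_group G act)" by (simp add: cocycle_group_def)
  have "coboundaries G act #>\<^bsub>cocycle_group G act\<^esub> f \<in> carrier (H1 G act)"
    using f by (auto simp: H1_def FactGroup_def RCOSETS_def)
  then have "coboundaries G act #>\<^bsub>cocycle_group G act\<^esub> f = coboundaries G act"
    using assms by (auto simp: trivial_group_def H1_def FactGroup_def)
  then show "f \<in> coboundaries G act"
    using C.rcos_self[OF f subgroup_coboundaries] by simp
qed

end

lemma Lp_const_on_infinite:
  assumes a: "a \<in> Lp G p" and B: "B \<subseteq> carrier G" "infinite B" and k: "\<And>x. x \<in> B \<Longrightarrow> a x = k"
  shows "k = 0"
proof -
  have "(\<lambda>x. cmod (a x) powr p) summable_on carrier G"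
    using a by (simp add: Lp_def)
  then have "(\<lambda>x. cmod (a x) powr p) summable_on B"
    using B(1) by (rule summable_on_subset_banach)
  then have "(\<lambda>x. cmod k powr p) summable_on B"
    by (rule summable_on_cong[THEN iffD1, rotated]) (simp add: k)
  then have "cmod k powr p = 0"
    using B(2) infsum_diverge_constant[of B "cmod k powr p"] by blast
  then show ?thesis by simp
qed

context group
begin

lemma left_translate_add:
  "left_translate G g (a + b) = left_translate G g a + left_translate G g b"
  and left_translate_diff:
  "left_translate G g (a - b) = left_translate G g a - left_translate G g b"
  by (auto simp: left_translate_def fun_eq_iff)

lemma left_translate_mult:
  assumes "g \<in> carrier G" "h \<in> carrier G"
  shows "left_translate G (g \<otimes> h) a = left_translate G g (left_translate G h a)"
  using assms by (auto simp: left_translate_def fun_eq_iff inv_mult_group m_assoc)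

lemma left_invariant_const:
  assumes inv: "\<And>g. g \<in> carrier G \<Longrightarrow> left_translate G g a = a" and x: "x \<in> carrier G"
  shows "a x = a \<one>"
  using fun_cong[OF inv[OF x], of x] x by (simp add: left_translate_def)

end

text \<open>If the coboundary of a function \<open>u\<close> takes values in a submodule \<open>M\<close> of the formal sums with
  vanishing first cohomology, then \<open>u\<close> differs from an element of \<open>M\<close> by a constant.\<close>

lemma (in G_module) constant_plus_element:
  assumes incl: "formal_sum_inclusion G cscale act \<iota>"
    and H1: "trivial_group (H1 G act)"
    and u: "\<And>g. g \<in> carrier G \<Longrightarrow> left_translate G g u - u \<in> range \<iota>"
  obtains \<alpha> c where "\<And>x. x \<in> carrier G \<Longrightarrow> \<iota> \<alpha> x = u x - c"
proof -
  interpret G: group G by (rule group_G)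
  have lin: "Vector_Spaces.linear cscale fun_cscale \<iota>" and inj: "inj \<iota>"
    and equi: "\<And>g x. g \<in> carrier G \<Longrightarrow> \<iota> (act g x) = left_translate G g (\<iota> x)"
    using incl by (auto simp: formal_sum_inclusion_def)
  interpret \<iota>: Vector_Spaces.linear cscale fun_cscale \<iota> by (rule lin)
  define f where "f = (\<lambda>g\<in>carrier G. inv_into UNIV \<iota> (left_translate G g u - u))"
  have \<iota>f: "\<iota> (f g) = left_translate G g u - u" if "g \<in> carrier G" for g
    using that u by (simp add: f_def f_inv_into_f)
  have "act a (f b) - f (a \<otimes> b) + f a = 0" if "a \<in> carrier G" "b \<in> carrier G" for a b
  proof (rule injD[OF inj])
    show "\<iota> (act a (f b) - f (a \<otimes> b) + f a) = \<iota> 0"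
      using that by (simp add: \<iota>.add \<iota>.diff \<iota>.zero equi \<iota>f G.left_translate_diff
          G.left_translate_mult)
  qed
  then have "f \<in> cocycles G act" by (auto simp: cocycles_def f_def)
  then have "f \<in> coboundaries G act" using cocycles_subset_coboundaries[OF H1] by blast
  then obtain \<alpha> where \<alpha>: "f = (\<lambda>b\<in>carrier G. act b \<alpha> - \<alpha>)"
    by (auto simp: coboundaries_def)
  have "left_translate G g (u - \<iota> \<alpha>) = u - \<iota> \<alpha>" if g: "g \<in> carrier G" for g
  proof -
    have "left_translate G g u - u = left_translate G g (\<iota> \<alpha>) - \<iota> \<alpha>"
      using \<iota>f[OF g] g by (simp add: \<alpha> \<iota>.diff equi)
    then show ?thesis by (simp add: G.left_translate_diff algebra_simps)
  qed
  then have "(u - \<iota> \<alpha>) x = (u - \<iota> \<alpha>) \<one>" if "x \<in> carrier G" for x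
    using G.left_invariant_const that by blast
  then have "\<iota> \<alpha> x = u x - (u - \<iota> \<alpha>) \<one>" if "x \<in> carrier G" for x
    using that by (simp add: algebra_simps)
  then show ?thesis by (rule that)
qed


section \<open>Groups with vanishing cohomology have one end\<close>

theorem theorem2:
  fixes G :: "('g, 'c) monoid_scheme" (structure)
    and S :: "'g set"
    and cscale :: "complex \<Rightarrow> 'm::banach \<Rightarrow> 'm"
    and act :: "'g \<Rightarrow> 'm \<Rightarrow> 'm"
    and \<iota> :: "'m \<Rightarrow> 'g \<Rightarrow> complex"
    and p :: nat
  assumes "group G" and "infinite (carrier G)"
    and "finite S" and "S \<subseteq> carrier G" and "generate G S = carrier G"
    and "complex_banach_space cscale"
    and "G_module G cscale act"
    and "\<And>g. g \<in> carrier G \<Longrightarrow> continuous_on UNIV (act g)"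
    and "p \<ge> 1"
    and "formal_sum_inclusion G cscale act \<iota>"
    and "group_ring G \<subseteq> range \<iota>" and "range \<iota> \<subseteq> Lp G (real p)"
    and "trivial_group (H1 G act)"
  shows "card (ends (cayley_adj G S)) = 1"
proof -
  interpret group G by fact
  interpret M: G_module G cscale act by fact
  let ?E = "cayley_adj G S"
  have equivalent: "(r, s) \<in> end_rel ?E" if r: "r \<in> rays ?E" and s: "s \<in> rays ?E" for r s
  proof (rule ccontr)
    assume "(r, s) \<notin> end_rel ?E"
    then obtain K A where K: "finite K"
      and rA: "infinite (range r \<inter> A)" and sA: "infinite (range s - A)"
      and bd: "\<And>x y. x \<in> A \<Longrightarrow> ?E x y \<Longrightarrow> y \<in> A \<union> K"
      using inequivalent_rays_separated[OF symp_cayley_adj r s] by blast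
    \<comment> \<open>Inversion turns right translates of \<open>A\<close> into left translates of \<open>B\<close>.\<close>
    define B where "B = {x \<in> carrier G. inv x \<in> A}"
    define u :: "'g \<Rightarrow> complex" where "u x = of_bool (x \<in> B)" for x
    have inf_inv: "infinite (m_inv G ` Y)" if "Y \<subseteq> carrier G" "infinite Y" for Y
      using that finite_imageD[of "m_inv G" Y] inv_inj by (auto intro: inj_on_subset)
    have "m_inv G ` (range r \<inter> A) \<subseteq> B"
      using rays_in_carrier[OF r] by (auto simp: B_def)
    then have inf_B: "infinite B"
      using inf_inv[of "range r \<inter> A"] rA rays_in_carrier[OF r] infinite_super by blast
    have "m_inv G ` (range s - A) \<subseteq> carrier G - B"
      using rays_in_carrier[OF s] by (auto simp: B_def)
    then have inf_coB: "infinite (carrier G - B)"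
      using inf_inv[of "range s - A"] sA rays_in_carrier[OF s] infinite_super by blast
    have "left_translate G g u - u \<in> group_ring G" if g: "g \<in> carrier G" for g
    proof -
      let ?D = "{x \<in> carrier G. x \<in> A \<longleftrightarrow> x \<otimes> g \<notin> A}"
      have "{x. (left_translate G g u - u) x \<noteq> 0} \<subseteq> m_inv G ` ?D"
      proof
        fix x assume "x \<in> {x. (left_translate G g u - u) x \<noteq> 0}"
        then have x: "x \<in> carrier G" "inv g \<otimes> x \<in> B \<longleftrightarrow> x \<notin> B"
          by (auto simp: left_translate_def u_def B_def split: if_splits)
        then have "inv x \<in> ?D"
          using g by (auto simp: B_def inv_mult_group)
        then show "x \<in> m_inv G ` ?D"
          using x by (intro image_eqI[of _ _ "inv x"]) auto
      qed
      moreover have "finite ?D"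
        by (rule almost_right_invariant[OF assms(4) K]) (use bd assms(5) g in auto)
      ultimately have "finite {x. (left_translate G g u - u) x \<noteq> 0}"
        by (meson finite_imageI finite_subset)
      then show ?thesis
        by (auto simp: group_ring_def left_translate_def u_def B_def)
    qed
    then have "\<And>g. g \<in> carrier G \<Longrightarrow> left_translate G g u - u \<in> range \<iota>"
      using assms(11) by blast
    then obtain \<alpha> c where \<alpha>: "\<And>x. x \<in> carrier G \<Longrightarrow> \<iota> \<alpha> x = u x - c"
      using M.constant_plus_element[OF assms(10,13)] by blast
    have Lp: "\<iota> \<alpha> \<in> Lp G (real p)" using assms(12) by blast
    have "1 - c = 0"
      by (rule Lp_const_on_infinite[OF Lp _ inf_B]) (auto simp: \<alpha> u_def B_def)
    moreover have "- c = 0"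
      by (rule Lp_const_on_infinite[OF Lp _ inf_coB]) (auto simp: \<alpha> u_def)
    ultimately show False by simp
  qed
  obtain r where r: "r \<in> rays ?E"
    using cayley_rays_nonempty[OF assms(2-5)] by blast
  have "end_rel ?E `` {s} = rays ?E" if "s \<in> rays ?E" for s
    using equivalent that by (auto simp: end_rel_def)
  then have "ends ?E = {rays ?E}"
    using r by (auto simp: ends_def quotient_def)
  then show ?thesis by simp
qed

end
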